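(* Let $G$ be a $\overline{C}$-group. Then the structure group $A(G)$, with the maps $\pi\colon A(G)\to G$ and $\mathrm{Ab}\colon A(G)\to\mathbb{Z}^{\mathfrak{C}(G)}$, is the pullback $$A(G)\ \cong\ G\underset{\mathrm{Ab},\,\mathrm{Ab}(G),\,\overline{\pi}}{\times}\mathbb{Z}^{\mathfrak{C}(G)}=\{(a,x)\in G\times\mathbb{Z}^{\mathfrak{C}(G)}\mid \mathrm{Ab}(a)=\overline{\pi}(x)\}.$$
   Context: For a group $G$, put $A(G)=\langle e_a,\ a\in G \mid e_ae_b=e_b e_{b^{-1}ab},\ a,b\in G\rangle$. The set of conjugacy classes of $G$ is $\mathfrak{C}(G)$. For a set $X$, $\mathbb{Z}^{X}$ denotes the free abelian group with basis $(c_x)_{x\in X}$ (direct sum). The homomorphism $\pi\colon A(G)\to G$ is defined by $e_a\mapsto a$, and $\mathrm{Ab}\colon A(G)\to\mathbb{Z}^{\mathfrak{C}(G)}$ (the abelianisation map of $A(G)$) by $e_a\mapsto c_{\mathcal{O}}$, where $\mathcal{O}$ is the conjugacy class of $a$. Also, $\mathrm{Ab}\colon G\to\mathrm{Ab}(G)$ denotes the abelianisation map of $G$. The map $\overline{\pi}\colon\mathbb{Z}^{\mathfrak{C}(G)}\to\mathrm{Ab}(G)$ is the unique homomorphism with $\overline{\pi}\circ\mathrm{Ab}=\mathrm{Ab}\circ\pi$ on $A(G)$; explicitly, it sends $c_{\mathcal{O}}$ to the class in $\mathrm{Ab}(G)$ of any $a\in\mathcal{O}$. A $\overline{C}$-group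 is a group $G$ admitting a presentation, with some generator set $\Gamma$, in which every relation is either a conjugation relation $b^{-1}ab=c$ with $a,b,c\in\Gamma$, or a power relation $a^k=1$ with $a\in\Gamma$, $k\ge 2$; there is at most one power relation per conjugacy class of $G$ (i.e., for each conjugacy class $\mathcal{O}$ of $G$, at most one power relation $a^k=1$ has $a\in\mathcal{O}$). *)

theory Defs
  imports "HOL-Algebra.Generated_Groups" "HOL-Algebra.Free_Abelian_Groups"
begin

section \<open>Group presentations\<close>

datatype 'g letter = Gen 'g | Gen_inv 'g

definition words :: "'g set \<Rightarrow> 'g letter list set"
  where "words \<Gamma> = lists (Gen ` \<Gamma> \<union> Gen_inv ` \<Gamma>)"

text \<open>A relation \<open>u = v\<close> is encoded as the pair \<open>(u, v)\<close> of words over \<open>\<Gamma>\<close>. Two words are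
  congruent iff they represent the same element of the group \<open>\<langle>\<Gamma> | R\<rangle>\<close>; this is the smallest
  congruence on the monoid \<open>words \<Gamma>\<close> that contains \<open>R\<close> and makes \<open>Gen x\<close> and \<open>Gen_inv x\<close> inverse
  to each other.\<close>

inductive pres_cong ::
  "'g set \<Rightarrow> ('g letter list \<times> 'g letter list) set \<Rightarrow> 'g letter list \<Rightarrow> 'g letter list \<Rightarrow> bool"
  for \<Gamma> R where
  refl: "u \<in> words \<Gamma> \<Longrightarrow> pres_cong \<Gamma> R u u"
| sym: "pres_cong \<Gamma> R u v \<Longrightarrow> pres_cong \<Gamma> R v u"
| trans: "pres_cong \<Gamma> R u v \<Longrightarrow> pres_cong \<Gamma> R v w \<Longrightarrow> pres_cong \<Gamma> R u w"
| append: "pres_cong \<Gamma> R u u' \<Longrightarrow> pres_cong \<Gamma> R v v' \<Longrightarrow> pres_cong \<Gamma> R (u @ v) (u' @ v')"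
| right_inv: "x \<in> \<Gamma> \<Longrightarrow> pres_cong \<Gamma> R [Gen x, Gen_inv x] []"
| left_inv: "x \<in> \<Gamma> \<Longrightarrow> pres_cong \<Gamma> R [Gen_inv x, Gen x] []"
| rel: "(u, v) \<in> R \<Longrightarrow> u \<in> words \<Gamma> \<Longrightarrow> v \<in> words \<Gamma> \<Longrightarrow> pres_cong \<Gamma> R u v"

definition pres_class ::
  "'g set \<Rightarrow> ('g letter list \<times> 'g letter list) set \<Rightarrow> 'g letter list \<Rightarrow> 'g letter list set"
  where "pres_class \<Gamma> R u = {v. pres_cong \<Gamma> R u v}"

definition presented_group ::
  "'g set \<Rightarrow> ('g letter list \<times> 'g letter list) set \<Rightarrow> 'g letter list set monoid"
  where "presented_group \<Gamma> R =
    \<lparr>carrier = pres_class \<Gamma> R ` words \<Gamma>,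
     monoid.mult = (\<lambda>X Y. \<Union>u\<in>X. \<Union>v\<in>Y. pres_class \<Gamma> R (u @ v)),
     one = pres_class \<Gamma> R []\<rparr>"

fun word_eval :: "('h, 'm) monoid_scheme \<Rightarrow> ('g \<Rightarrow> 'h) \<Rightarrow> 'g letter list \<Rightarrow> 'h"
  where
  "word_eval H f [] = \<one>\<^bsub>H\<^esub>"
| "word_eval H f (Gen x # w) = f x \<otimes>\<^bsub>H\<^esub> word_eval H f w"
| "word_eval H f (Gen_inv x # w) = inv\<^bsub>H\<^esub> (f x) \<otimes>\<^bsub>H\<^esub> word_eval H f w"

text \<open>The homomorphism from a presented group to \<open>H\<close> that extends \<open>f\<close>, meaningful when \<open>f\<close>
  respects the relations; see \<open>presented_lift_hom\<close> and \<open>presented_lift_gen\<close>.\<close>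

definition presented_lift :: "('h, 'm) monoid_scheme \<Rightarrow> ('g \<Rightarrow> 'h) \<Rightarrow> 'g letter list set \<Rightarrow> 'h"
  where "presented_lift H f X = the_elem (word_eval H f ` X)"


lemma words_simps [simp]:
  "[] \<in> words \<Gamma>"
  "u @ v \<in> words \<Gamma> \<longleftrightarrow> u \<in> words \<Gamma> \<and> v \<in> words \<Gamma>"
  "Gen x # u \<in> words \<Gamma> \<longleftrightarrow> x \<in> \<Gamma> \<and> u \<in> words \<Gamma>"
  "Gen_inv x # u \<in> words \<Gamma> \<longleftrightarrow> x \<in> \<Gamma> \<and> u \<in> words \<Gamma>"
  by (auto simp: words_def)

lemma pres_cong_words: "pres_cong \<Gamma> R u v \<Longrightarrow> u \<in> words \<Gamma> \<and> v \<in> words \<Gamma>"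
  by (induction rule: pres_cong.induct) auto

lemma pres_class_eq_iff:
  assumes "u \<in> words \<Gamma>"
  shows "pres_class \<Gamma> R u = pres_class \<Gamma> R v \<longleftrightarrow> pres_cong \<Gamma> R u v"
proof
  assume "pres_class \<Gamma> R u = pres_class \<Gamma> R v"
  then have "u \<in> pres_class \<Gamma> R v"
    using assms by (auto simp: pres_class_def intro: pres_cong.refl)
  then show "pres_cong \<Gamma> R u v" unfolding pres_class_def by (blast intro: pres_cong.sym)
next
  assume "pres_cong \<Gamma> R u v"
  then show "pres_class \<Gamma> R u = pres_class \<Gamma> R v"
    unfolding pres_class_def by (blast intro: pres_cong.sym pres_cong.trans)
qed

lemma presented_group_mult:
  assumes "u \<in> words \<Gamma>" "v \<in> words \<Gamma>"
  shows "pres_class \<Gamma> R u \<otimes>\<^bsub>presented_group \<Gamma> R\<^esub> pres_class \<Gamma> R v = pres_class \<Gamma> R (u @ v)"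
proof -
  have "pres_class \<Gamma> R (u' @ v') = pres_class \<Gamma> R (u @ v)"
    if "u' \<in> pres_class \<Gamma> R u" "v' \<in> pres_class \<Gamma> R v" for u' v'
    using that assms pres_class_eq_iff[of "u @ v" \<Gamma> R "u' @ v'"]
    by (auto simp: pres_class_def intro: pres_cong.append)
  moreover have "u \<in> pres_class \<Gamma> R u" "v \<in> pres_class \<Gamma> R v"
    using assms by (auto simp: pres_class_def intro: pres_cong.refl)
  ultimately have "(\<Union>u'\<in>pres_class \<Gamma> R u. \<Union>v'\<in>pres_class \<Gamma> R v. pres_class \<Gamma> R (u' @ v')) =
      pres_class \<Gamma> R (u @ v)" by blast
  then show ?thesis by (simp add: presented_group_def)
qed

lemma pres_class_closed [simp]:
  "u \<in> words \<Gamma> \<Longrightarrow> pres_class \<Gamma> R u \<in> carrier (presented_group \<Gamma> R)"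
  by (simp add: presented_group_def)

lemma presented_groupE:
  assumes "X \<in> carrier (presented_group \<Gamma> R)"
  obtains u where "u \<in> words \<Gamma>" "X = pres_class \<Gamma> R u"
  using assms by (auto simp: presented_group_def)

lemma pres_cong_inverse:
  assumes "u \<in> words \<Gamma>"
  shows "\<exists>v\<in>words \<Gamma>. pres_cong \<Gamma> R (v @ u) []"
  using assms
proof (induction u)
  case Nil
  then show ?case using pres_cong.refl[of "[]" \<Gamma> R] by (intro bexI[of _ "[]"]) simp_all
next
  case (Cons l u)
  obtain x where l: "l = Gen x \<or> l = Gen_inv x" by (cases l) auto
  define l' where "l' = (if l = Gen x then Gen_inv x else Gen x)"
  have x: "x \<in> \<Gamma>" and u: "u \<in> words \<Gamma>" using Cons.prems l by auto
  obtain v where v: "v \<in> words \<Gamma>" "pres_cong \<Gamma> R (v @ u) []" using Cons.IH[OF u] by blast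
  have "pres_cong \<Gamma> R [l', l] []"
    using l x by (auto simp: l'_def intro: pres_cong.right_inv pres_cong.left_inv)
  then have "pres_cong \<Gamma> R (v @ [l', l] @ u) (v @ [] @ u)"
    using u v(1) by (blast intro: pres_cong.append pres_cong.refl)
  then have "pres_cong \<Gamma> R ((v @ [l']) @ l # u) []"
    using pres_cong.trans[OF _ v(2)] by simp
  moreover have "v @ [l'] \<in> words \<Gamma>" using v x by (auto simp: l'_def)
  ultimately show ?case by blast
qed

lemma group_presented_group: "group (presented_group \<Gamma> R)"
proof (rule groupI)
  show one: "\<one>\<^bsub>presented_group \<Gamma> R\<^esub> \<in> carrier (presented_group \<Gamma> R)"
    by (simp add: presented_group_def)
  have one_eq: "\<one>\<^bsub>presented_group \<Gamma> R\<^esub> = pres_class \<Gamma> R []"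
    by (simp add: presented_group_def)
  fix X assume "X \<in> carrier (presented_group \<Gamma> R)"
  then obtain u where u: "u \<in> words \<Gamma>" "X = pres_class \<Gamma> R u" by (rule presented_groupE)
  then show "\<one>\<^bsub>presented_group \<Gamma> R\<^esub> \<otimes>\<^bsub>presented_group \<Gamma> R\<^esub> X = X"
    by (simp add: one_eq presented_group_mult)
  obtain v where v: "v \<in> words \<Gamma>" "pres_cong \<Gamma> R (v @ u) []"
    using pres_cong_inverse[OF u(1)] by blast
  then show "\<exists>Y\<in>carrier (presented_group \<Gamma> R). Y \<otimes>\<^bsub>presented_group \<Gamma> R\<^esub> X = \<one>\<^bsub>presented_group \<Gamma> R\<^esub>"
    using u by (intro bexI[of _ "pres_class \<Gamma> R v"])
      (simp_all add: one_eq presented_group_mult pres_class_eq_iff)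
  fix Y assume "Y \<in> carrier (presented_group \<Gamma> R)"
  then obtain v where v: "v \<in> words \<Gamma>" "Y = pres_class \<Gamma> R v" by (rule presented_groupE)
  then show "X \<otimes>\<^bsub>presented_group \<Gamma> R\<^esub> Y \<in> carrier (presented_group \<Gamma> R)"
    using u by (simp add: presented_group_mult)
  fix Z assume "Z \<in> carrier (presented_group \<Gamma> R)"
  then obtain w where w: "w \<in> words \<Gamma>" "Z = pres_class \<Gamma> R w" by (rule presented_groupE)
  then show "X \<otimes>\<^bsub>presented_group \<Gamma> R\<^esub> Y \<otimes>\<^bsub>presented_group \<Gamma> R\<^esub> Z =
      X \<otimes>\<^bsub>presented_group \<Gamma> R\<^esub> (Y \<otimes>\<^bsub>presented_group \<Gamma> R\<^esub> Z)"
    using u v by (simp add: presented_group_mult)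
qed

context group
begin

lemma word_eval_closed:
  assumes "f \<in> \<Gamma> \<rightarrow> carrier G" "u \<in> words \<Gamma>"
  shows "word_eval G f u \<in> carrier G"
  using assms(2)
proof (induction u)
  case (Cons l u)
  then show ?case using assms(1) by (cases l) auto
qed auto

lemma word_eval_append:
  assumes "f \<in> \<Gamma> \<rightarrow> carrier G" "u \<in> words \<Gamma>" "v \<in> words \<Gamma>"
  shows "word_eval G f (u @ v) = word_eval G f u \<otimes> word_eval G f v"
  using assms(2)
proof (induction u)
  case Nil
  then show ?case using word_eval_closed[OF assms(1,3)] by simp
next
  case (Cons l u)
  have "word_eval G f v \<in> carrier G" using assms word_eval_closed by blast
  moreover have "word_eval G f u \<in> carrier G"
    using Cons.prems assms word_eval_closed by (cases l) auto
  moreover have "\<And>x. x \<in> \<Gamma> \<Longrightarrow> f x \<in> carrier G" using assms(1) by auto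
  ultimately show ?case using Cons by (cases l) (auto simp: m_assoc)
qed

lemma word_eval_cong:
  assumes f: "f \<in> \<Gamma> \<rightarrow> carrier G"
    and R: "\<And>u v. (u, v) \<in> R \<Longrightarrow> word_eval G f u = word_eval G f v"
    and uv: "pres_cong \<Gamma> R u v"
  shows "word_eval G f u = word_eval G f v"
  using uv
proof (induction rule: pres_cong.induct)
  case (append u u' v v')
  then show ?case using word_eval_append[OF f] pres_cong_words by metis
next
  case (right_inv x)
  then have "f x \<in> carrier G" using f by auto
  then show ?case by simp
next
  case (left_inv x)
  then have "f x \<in> carrier G" using f by auto
  then show ?case by simp
qed (use R in auto)

lemma presented_lift_class:
  assumes f: "f \<in> \<Gamma> \<rightarrow> carrier G"
    and R: "\<And>u v. (u, v) \<in> R \<Longrightarrow> word_eval G f u = word_eval G f v"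
    and u: "u \<in> words \<Gamma>"
  shows "presented_lift G f (pres_class \<Gamma> R u) = word_eval G f u"
proof -
  have "u \<in> pres_class \<Gamma> R u" using u by (simp add: pres_class_def pres_cong.refl)
  moreover have "word_eval G f v = word_eval G f u" if "v \<in> pres_class \<Gamma> R u" for v
    using that word_eval_cong[OF f R, where u = u and v = v] by (auto simp: pres_class_def)
  ultimately have "word_eval G f ` pres_class \<Gamma> R u = {word_eval G f u}" by blast
  then show ?thesis by (simp add: presented_lift_def)
qed

lemma presented_lift_hom:
  assumes f: "f \<in> \<Gamma> \<rightarrow> carrier G"
    and R: "\<And>u v. (u, v) \<in> R \<Longrightarrow> word_eval G f u = word_eval G f v"
  shows "presented_lift G f \<in> hom (presented_group \<Gamma> R) G"
proof (rule homI)
  note lift = presented_lift_class[OF f R]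
  fix X assume "X \<in> carrier (presented_group \<Gamma> R)"
  then obtain u where u: "u \<in> words \<Gamma>" "X = pres_class \<Gamma> R u" by (rule presented_groupE)
  then show "presented_lift G f X \<in> carrier G" using lift word_eval_closed[OF f] by simp
  fix Y assume "Y \<in> carrier (presented_group \<Gamma> R)"
  then obtain v where v: "v \<in> words \<Gamma>" "Y = pres_class \<Gamma> R v" by (rule presented_groupE)
  show "presented_lift G f (X \<otimes>\<^bsub>presented_group \<Gamma> R\<^esub> Y) = presented_lift G f X \<otimes> presented_lift G f Y"
    using u v by (simp add: lift presented_group_mult word_eval_append[OF f])
qed

lemma presented_lift_gen:
  assumes "f \<in> \<Gamma> \<rightarrow> carrier G"
    and "\<And>u v. (u, v) \<in> R \<Longrightarrow> word_eval G f u = word_eval G f v"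
    and "x \<in> \<Gamma>"
  shows "presented_lift G f (pres_class \<Gamma> R [Gen x]) = f x"
proof -
  have "f x \<in> carrier G" using assms(1,3) by auto
  then show ?thesis
    using presented_lift_class[OF assms(1,2), where R = R and u = "[Gen x]"] assms(3) by simp
qed

lemma presented_group_hom_unique:
  assumes f: "f \<in> hom (presented_group \<Gamma> R) G" and h: "h \<in> hom (presented_group \<Gamma> R) G"
    and gen: "\<And>x. x \<in> \<Gamma> \<Longrightarrow> f (pres_class \<Gamma> R [Gen x]) = h (pres_class \<Gamma> R [Gen x])"
    and X: "X \<in> carrier (presented_group \<Gamma> R)"
  shows "f X = h X"
proof -
  let ?P = "presented_group \<Gamma> R"
  interpret P: group ?P by (rule group_presented_group)
  interpret f: group_hom ?P G f by unfold_locales (rule f)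
  interpret h: group_hom ?P G h by unfold_locales (rule h)
  have letter: "f (pres_class \<Gamma> R [l]) = h (pres_class \<Gamma> R [l])" if "[l] \<in> words \<Gamma>" for l
  proof (cases l)
    case (Gen x)
    then show ?thesis using gen that by simp
  next
    case (Gen_inv x)
    then have x: "x \<in> \<Gamma>" using that by simp
    then have "pres_class \<Gamma> R [Gen_inv x] \<otimes>\<^bsub>?P\<^esub> pres_class \<Gamma> R [Gen x] = pres_class \<Gamma> R []"
      by (simp add: presented_group_mult pres_class_eq_iff pres_cong.left_inv)
    also have "\<dots> = \<one>\<^bsub>?P\<^esub>" by (simp add: presented_group_def)
    finally have "pres_class \<Gamma> R [Gen_inv x] = inv\<^bsub>?P\<^esub> (pres_class \<Gamma> R [Gen x])"
      using x by (intro P.inv_equality[symmetric]) simp_all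
    then show ?thesis using x gen Gen_inv by simp
  qed
  have "f (pres_class \<Gamma> R u) = h (pres_class \<Gamma> R u)" if "u \<in> words \<Gamma>" for u
    using that
  proof (induction u)
    case Nil
    have "pres_class \<Gamma> R [] = \<one>\<^bsub>?P\<^esub>" by (simp add: presented_group_def)
    then show ?case by simp
  next
    case (Cons l u)
    have l: "[l] \<in> words \<Gamma>" and u: "u \<in> words \<Gamma>" using Cons.prems by (cases l; simp)+
    have "pres_class \<Gamma> R (l # u) = pres_class \<Gamma> R [l] \<otimes>\<^bsub>?P\<^esub> pres_class \<Gamma> R u"
      using presented_group_mult[OF l u] by simp
    then show ?case using Cons.IH[OF u] letter[OF l] l u by simp
  qed
  then show ?thesis using X by (auto elim: presented_groupE)
qed

end


section \<open>Conjugacy classes and abelianisation\<close>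

definition conj_class :: "('a, 'm) monoid_scheme \<Rightarrow> 'a \<Rightarrow> 'a set"
  where "conj_class G a = {inv\<^bsub>G\<^esub> g \<otimes>\<^bsub>G\<^esub> a \<otimes>\<^bsub>G\<^esub> g | g. g \<in> carrier G}"

definition conj_classes :: "('a, 'm) monoid_scheme \<Rightarrow> 'a set set"
  where "conj_classes G = conj_class G ` carrier G"

definition abelianisation :: "('a, 'm) monoid_scheme \<Rightarrow> 'a set monoid"
  where "abelianisation G = G Mod derived G (carrier G)"

definition ab_map :: "('a, 'm) monoid_scheme \<Rightarrow> 'a \<Rightarrow> 'a set"
  where "ab_map G a = derived G (carrier G) #>\<^bsub>G\<^esub> a"


section \<open>The structure group and its maps\<close>

definition structure_relations :: "('a, 'm) monoid_scheme \<Rightarrow> ('a letter list \<times> 'a letter list) set"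
  where "structure_relations G =
    {([Gen a, Gen b], [Gen b, Gen (inv\<^bsub>G\<^esub> b \<otimes>\<^bsub>G\<^esub> a \<otimes>\<^bsub>G\<^esub> b)]) | a b. a \<in> carrier G \<and> b \<in> carrier G}"

definition structure_group :: "('a, 'm) monoid_scheme \<Rightarrow> 'a letter list set monoid"
  where "structure_group G = presented_group (carrier G) (structure_relations G)"

definition structure_gen :: "('a, 'm) monoid_scheme \<Rightarrow> 'a \<Rightarrow> 'a letter list set"
  where "structure_gen G a = pres_class (carrier G) (structure_relations G) [Gen a]"

definition structure_pi :: "('a, 'm) monoid_scheme \<Rightarrow> 'a letter list set \<Rightarrow> 'a"
  where "structure_pi G = presented_lift G (\<lambda>a. a)"

definition structure_Ab :: "('a, 'm) monoid_scheme \<Rightarrow> 'a letter list set \<Rightarrow> 'a set \<Rightarrow>\<^sub>0 int"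
  where "structure_Ab G =
    presented_lift (free_Abelian_group (conj_classes G)) (\<lambda>a. frag_of (conj_class G a))"

text \<open>The homomorphism that sends the basis element of a conjugacy class \<open>Q\<close> to the common image
  of the elements of \<open>Q\<close> in the abelianisation; by \<open>pi_bar_structure_Ab\<close> and
  \<open>pi_bar_unique\<close> it is the unique one with \<open>pi_bar \<circ> structure_Ab = ab_map \<circ> structure_pi\<close>.\<close>

definition pi_bar :: "('a, 'm) monoid_scheme \<Rightarrow> ('a set \<Rightarrow>\<^sub>0 int) \<Rightarrow> 'a set"
  where "pi_bar G x =
    gfinprod (abelianisation G)
      (\<lambda>Q. the_elem (ab_map G ` Q) [^]\<^bsub>abelianisation G\<^esub> poly_mapping.lookup x Q) (conj_classes G)"

definition fibre_product :: "('a, 'm) monoid_scheme \<Rightarrow> ('a \<times> ('a set \<Rightarrow>\<^sub>0 int)) monoid"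
  where "fibre_product G =
    (G \<times>\<times> free_Abelian_group (conj_classes G))
      \<lparr>carrier := {(a, x). a \<in> carrier G \<and> x \<in> carrier (free_Abelian_group (conj_classes G)) \<and>
                          ab_map G a = pi_bar G x}\<rparr>"

context group
begin

lemma comm_group_abelianisation: "comm_group (abelianisation G)"
  by (simp add: abelianisation_def derived_quot_is_comm_group)

lemma ab_map_hom: "ab_map G \<in> hom G (abelianisation G)"
  unfolding abelianisation_def ab_map_def
  using normal.r_coset_hom_Mod[OF derived_self_is_normal] by simp

lemma conj_class_self: "a \<in> carrier G \<Longrightarrow> a \<in> conj_class G a"
  unfolding conj_class_def by (rule CollectI, rule exI[of _ \<one>]) simp

lemma conj_class_conj:
  assumes [simp]: "a \<in> carrier G" "b \<in> carrier G"
  shows "conj_class G (inv b \<otimes> a \<otimes> b) = conj_class G a"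
proof
  show "conj_class G (inv b \<otimes> a \<otimes> b) \<subseteq> conj_class G a"
  proof
    fix x assume "x \<in> conj_class G (inv b \<otimes> a \<otimes> b)"
    then obtain g where g [simp]: "g \<in> carrier G" and x: "x = inv g \<otimes> (inv b \<otimes> a \<otimes> b) \<otimes> g"
      by (auto simp: conj_class_def)
    have "x = inv (b \<otimes> g) \<otimes> a \<otimes> (b \<otimes> g)" by (simp add: x m_assoc inv_mult_group)
    then show "x \<in> conj_class G a"
      unfolding conj_class_def by (intro CollectI exI[of _ "b \<otimes> g"]) simp
  qed
  show "conj_class G a \<subseteq> conj_class G (inv b \<otimes> a \<otimes> b)"
  proof
    fix x assume "x \<in> conj_class G a"
    then obtain g where g [simp]: "g \<in> carrier G" and x: "x = inv g \<otimes> a \<otimes> g"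
      by (auto simp: conj_class_def)
    have "b \<otimes> (inv b \<otimes> y) = y" if "y \<in> carrier G" for y
      using that by (simp flip: m_assoc)
    then have "x = inv (inv b \<otimes> g) \<otimes> (inv b \<otimes> a \<otimes> b) \<otimes> (inv b \<otimes> g)"
      by (simp add: x m_assoc inv_mult_group)
    then show "x \<in> conj_class G (inv b \<otimes> a \<otimes> b)"
      unfolding conj_class_def by (intro CollectI exI[of _ "inv b \<otimes> g"]) simp
  qed
qed

lemma the_elem_ab_map:
  assumes a: "a \<in> carrier G"
  shows "the_elem (ab_map G ` conj_class G a) = ab_map G a"
proof -
  interpret A: comm_group "abelianisation G" by (rule comm_group_abelianisation)
  interpret h: group_hom G "abelianisation G" "ab_map G"
    by unfold_locales (rule ab_map_hom)
  have "ab_map G (inv g \<otimes> a \<otimes> g) = ab_map G a" if g: "g \<in> carrier G" for g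
  proof -
    have "ab_map G (inv g \<otimes> a \<otimes> g) =
        inv\<^bsub>abelianisation G\<^esub> ab_map G g \<otimes>\<^bsub>abelianisation G\<^esub> ab_map G a \<otimes>\<^bsub>abelianisation G\<^esub> ab_map G g"
      using a g by simp
    also have "\<dots> = ab_map G a"
      using a g by (metis A.inv_solve_left A.m_comm A.m_closed A.inv_closed h.hom_closed)
    finally show ?thesis .
  qed
  then have "ab_map G ` conj_class G a = {ab_map G a}"
    using conj_class_self[OF a] by (auto simp: conj_class_def)
  then show ?thesis by simp
qed

lemma structure_pi_hom: "structure_pi G \<in> hom (structure_group G) G"
  and structure_pi_gen: "a \<in> carrier G \<Longrightarrow> structure_pi G (structure_gen G a) = a"
proof -
  have R: "word_eval G (\<lambda>a. a) u = word_eval G (\<lambda>a. a) v" if uv: "(u, v) \<in> structure_relations G" for u v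
  proof -
    obtain a b where ab: "a \<in> carrier G" "b \<in> carrier G"
      "u = [Gen a, Gen b]" "v = [Gen b, Gen (inv b \<otimes> a \<otimes> b)]"
      using uv by (auto simp: structure_relations_def)
    then have "b \<otimes> (inv b \<otimes> a \<otimes> b) = a \<otimes> b" by (simp flip: m_assoc)
    then show ?thesis using ab by simp
  qed
  show "structure_pi G \<in> hom (structure_group G) G"
    unfolding structure_pi_def structure_group_def by (rule presented_lift_hom) (use R in auto)
  show "structure_pi G (structure_gen G a) = a" if "a \<in> carrier G"
    unfolding structure_pi_def structure_gen_def by (rule presented_lift_gen) (use R that in auto)
qed

lemma structure_Ab_hom:
    "structure_Ab G \<in> hom (structure_group G) (free_Abelian_group (conj_classes G))"
  and structure_Ab_gen:
    "a \<in> carrier G \<Longrightarrow> structure_Ab G (structure_gen G a) = frag_of (conj_class G a)"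
proof -
  let ?Z = "free_Abelian_group (conj_classes G)" and ?f = "\<lambda>a. frag_of (conj_class G a)"
  have f: "?f \<in> carrier G \<rightarrow> carrier ?Z" by (auto simp: conj_classes_def)
  have R: "word_eval ?Z ?f u = word_eval ?Z ?f v" if "(u, v) \<in> structure_relations G" for u v
    using that by (auto simp: structure_relations_def conj_class_conj)
  show "structure_Ab G \<in> hom (structure_group G) ?Z"
    unfolding structure_Ab_def structure_group_def
    by (rule group.presented_lift_hom[OF group_free_Abelian_group f]) (rule R)
  show "structure_Ab G (structure_gen G a) = ?f a" if "a \<in> carrier G"
    unfolding structure_Ab_def structure_gen_def
    by (rule group.presented_lift_gen[OF group_free_Abelian_group f R that])
qed

lemma pi_bar_hom: "pi_bar G \<in> hom (free_Abelian_group (conj_classes G)) (abelianisation G)"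
  and pi_bar_frag_of: "a \<in> carrier G \<Longrightarrow> pi_bar G (frag_of (conj_class G a)) = ab_map G a"
proof -
  interpret A: comm_group "abelianisation G" by (rule comm_group_abelianisation)
  let ?f = "\<lambda>Q. the_elem (ab_map G ` Q)" and ?S = "conj_classes G"
  have f: "?f Q \<in> carrier (abelianisation G)" if "Q \<in> ?S" for Q
    using that ab_map_hom by (auto simp: conj_classes_def the_elem_ab_map hom_def)
  have fin: "finite {Q \<in> ?S. ?f Q [^]\<^bsub>abelianisation G\<^esub> poly_mapping.lookup u Q \<noteq> \<one>\<^bsub>abelianisation G\<^esub>}"
    for u :: "'a set \<Rightarrow>\<^sub>0 int"
    by (rule finite_subset[OF _ finite_keys[of u]]) (force simp: in_keys_iff)
  show "pi_bar G \<in> hom (free_Abelian_group ?S) (abelianisation G)"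
  proof (rule homI)
    fix x :: "'a set \<Rightarrow>\<^sub>0 int"
    show "pi_bar G x \<in> carrier (abelianisation G)"
      unfolding pi_bar_def by (rule A.gfinprod_closed) (use f in auto)
    fix y :: "'a set \<Rightarrow>\<^sub>0 int"
    have "pi_bar G (x + y) = gfinprod (abelianisation G)
        (\<lambda>Q. ?f Q [^]\<^bsub>abelianisation G\<^esub> poly_mapping.lookup x Q
           \<otimes>\<^bsub>abelianisation G\<^esub> ?f Q [^]\<^bsub>abelianisation G\<^esub> poly_mapping.lookup y Q) ?S"
      unfolding pi_bar_def
      by (rule A.gfinprod_cong) (use f in \<open>auto simp: simp_implies_def lookup_add A.int_pow_mult\<close>)
    also have "\<dots> = pi_bar G x \<otimes>\<^bsub>abelianisation G\<^esub> pi_bar G y"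
      unfolding pi_bar_def by (rule A.gfinprod_distrib) (use f fin in auto)
    finally show "pi_bar G (x \<otimes>\<^bsub>free_Abelian_group ?S\<^esub> y) =
        pi_bar G x \<otimes>\<^bsub>abelianisation G\<^esub> pi_bar G y" by simp
  qed
  assume a: "a \<in> carrier G"
  let ?Q = "conj_class G a"
  have Q: "?Q \<in> ?S" using a by (simp add: conj_classes_def)
  have "pi_bar G (frag_of ?Q) = gfinprod (abelianisation G)
      (\<lambda>Q. ?f Q [^]\<^bsub>abelianisation G\<^esub> poly_mapping.lookup (frag_of ?Q) Q) {?Q}"
    unfolding pi_bar_def
    by (rule A.gfinprod_mono_neutral_cong_right) (use Q f in auto)
  also have "\<dots> = ab_map G a"
    using f[OF Q] by (simp add: the_elem_ab_map a A.finprod_singleton)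
  finally show "pi_bar G (frag_of ?Q) = ab_map G a" .
qed

lemma pi_bar_structure_Ab:
  assumes "z \<in> carrier (structure_group G)"
  shows "pi_bar G (structure_Ab G z) = ab_map G (structure_pi G z)"
proof -
  interpret A: comm_group "abelianisation G" by (rule comm_group_abelianisation)
  have "(pi_bar G \<circ> structure_Ab G) z = (ab_map G \<circ> structure_pi G) z"
  proof (rule A.presented_group_hom_unique)
    show "pi_bar G \<circ> structure_Ab G
        \<in> hom (presented_group (carrier G) (structure_relations G)) (abelianisation G)"
      using Group.hom_compose[OF structure_Ab_hom pi_bar_hom] by (simp add: structure_group_def)
    show "ab_map G \<circ> structure_pi G
        \<in> hom (presented_group (carrier G) (structure_relations G)) (abelianisation G)"
      using Group.hom_compose[OF structure_pi_hom ab_map_hom] by (simp add: structure_group_def)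
    show "z \<in> carrier (presented_group (carrier G) (structure_relations G))"
      using assms by (simp add: structure_group_def)
    fix a assume a: "a \<in> carrier G"
    show "(pi_bar G \<circ> structure_Ab G) (pres_class (carrier G) (structure_relations G) [Gen a]) =
        (ab_map G \<circ> structure_pi G) (pres_class (carrier G) (structure_relations G) [Gen a])"
      using a structure_Ab_gen[OF a] structure_pi_gen[OF a] pi_bar_frag_of[OF a]
      by (simp add: structure_gen_def)
  qed
  then show ?thesis by simp
qed

lemma pi_bar_unique:
  assumes h: "h \<in> hom (free_Abelian_group (conj_classes G)) (abelianisation G)"
    and comm: "\<And>z. z \<in> carrier (structure_group G) \<Longrightarrow> h (structure_Ab G z) = ab_map G (structure_pi G z)"
    and x: "x \<in> carrier (free_Abelian_group (conj_classes G))"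
  shows "h x = pi_bar G x"
proof -
  let ?Z = "free_Abelian_group (conj_classes G)"
  interpret A: comm_group "abelianisation G" by (rule comm_group_abelianisation)
  interpret Z: group ?Z by simp
  interpret h: group_hom ?Z "abelianisation G" h by unfold_locales (rule h)
  interpret p: group_hom ?Z "abelianisation G" "pi_bar G" by unfold_locales (rule pi_bar_hom)
  have "Poly_Mapping.keys x \<subseteq> conj_classes G" using x by simp
  then show ?thesis
  proof (rule free_Abelian_group_induct)
    show "h 0 = pi_bar G 0" using h.hom_one p.hom_one by simp
  next
    fix x y assume keys: "Poly_Mapping.keys x \<subseteq> conj_classes G" "Poly_Mapping.keys y \<subseteq> conj_classes G"
      and IH: "h x = pi_bar G x" "h y = pi_bar G y"
    have eq: "x - y = x \<otimes>\<^bsub>?Z\<^esub> inv\<^bsub>?Z\<^esub> y" using keys by simp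
    have "x \<in> carrier ?Z" "y \<in> carrier ?Z" using keys by simp_all
    then show "h (x - y) = pi_bar G (x - y)" unfolding eq
      using IH by (simp only: h.hom_mult p.hom_mult h.hom_inv p.hom_inv Z.inv_closed)
  next
    fix Q assume "Q \<in> conj_classes G"
    then obtain a where a: "a \<in> carrier G" and Q: "Q = conj_class G a" by (auto simp: conj_classes_def)
    have "structure_gen G a \<in> carrier (structure_group G)"
      using a by (simp add: structure_gen_def structure_group_def)
    then show "h (frag_of Q) = pi_bar G (frag_of Q)"
      using comm pi_bar_structure_Ab structure_Ab_gen[OF a] Q by metis
  qed
qed

end


section \<open>\<open>C\<close>-bar groups\<close>

definition conj_relation :: "'g \<Rightarrow> 'g \<Rightarrow> 'g \<Rightarrow> 'g letter list \<times> 'g letter list"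
  where "conj_relation a b c = ([Gen_inv b, Gen a, Gen b], [Gen c])"

definition power_relation :: "'g \<Rightarrow> nat \<Rightarrow> 'g letter list \<times> 'g letter list"
  where "power_relation a k = (replicate k (Gen a), [])"

text \<open>The generator symbols are taken from an arbitrary type \<open>'g\<close>, and distinct symbols may represent
  the same element of \<open>G\<close>. That a symbol \<open>a\<close> lies in a conjugacy class \<open>Q\<close> of \<open>G\<close> is said of the
  element of \<open>G\<close> that it represents under the isomorphism \<open>\<phi>\<close>.\<close>

definition Cbar_group :: "'g itself \<Rightarrow> ('a, 'm) monoid_scheme \<Rightarrow> bool"
  where "Cbar_group TYPE('g) G \<longleftrightarrow> group G \<and>
    (\<exists>(\<Gamma> :: 'g set) R \<phi>.
      (\<forall>r\<in>R. (\<exists>a\<in>\<Gamma>. \<exists>b\<in>\<Gamma>. \<exists>c\<in>\<Gamma>. r = conj_relation a b c) \<or>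
              (\<exists>a\<in>\<Gamma>. \<exists>k\<ge>2. r = power_relation a k)) \<and>
      \<phi> \<in> iso (presented_group \<Gamma> R) G \<and>
      (\<forall>Q\<in>conj_classes G. \<exists>\<^sub>\<le>\<^sub>1 r. r \<in> R \<and>
        (\<exists>a\<in>\<Gamma>. \<exists>k\<ge>2. r = power_relation a k \<and> \<phi> (pres_class \<Gamma> R [Gen a]) \<in> Q)))"

end

theory Submission
  imports Defs
begin

text \<open>
  Conjugation by \<open>z\<close> in the structure group \<open>A(G)\<close> permutes the generators \<open>e\<^sub>a\<close> according to
  conjugation by \<open>\<pi>(z)\<close>, so the kernel \<open>K\<close> of \<open>\<pi>\<close> is central. The kernel of \<open>Ab\<close> is the derived
  subgroup of \<open>A(G)\<close>, which \<open>\<pi>\<close> maps onto that of \<open>G\<close>; this gives surjectivity onto the fibre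
  product for every group.

  For injectivity, send a generator \<open>x\<close> of the presentation of \<open>G\<close> to \<open>e\<^sub>x\<close>. The conjugation
  relations hold in \<open>A(G)\<close>, so words that are equal in \<open>G\<close> have the same image modulo the central
  subgroup \<open>N\<close> generated by the elements \<open>e\<^sub>a\<^sup>k\<close> of the power relations. Since \<open>A(G)\<close> is the product of
  \<open>K\<close> and the subgroup of word images, every commutator is a word image, and a word image in \<open>K\<close>
  lies in \<open>N\<close>. Finally, \<open>Ab\<close> sends \<open>e\<^sub>a\<^sup>k\<close> to \<open>k\<close> times a basis element, and distinct power relations
  give distinct basis elements, so \<open>Ab\<close> is injective on \<open>N\<close>.
\<close>

section \<open>Word evaluation and commutators in arbitrary groups\<close>

lemma (in group_hom) hom_word_eval:
  assumes "f \<in> \<Gamma> \<rightarrow> carrier G" "u \<in> words \<Gamma>"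
  shows "h (word_eval G f u) = word_eval H (h \<circ> f) u"
  using assms(2)
proof (induction u)
  case (Cons l u)
  then have "u \<in> words \<Gamma>" by (cases l) auto
  then have "word_eval G f u \<in> carrier G" using assms(1) G.word_eval_closed by blast
  moreover have "\<And>x. x \<in> \<Gamma> \<Longrightarrow> f x \<in> carrier G" using assms(1) by auto
  ultimately show ?case using Cons by (cases l) auto
qed simp

lemma (in group) word_eval_subgroup:
  assumes "subgroup H G" "f \<in> \<Gamma> \<rightarrow> H" "u \<in> words \<Gamma>"
  shows "word_eval G f u \<in> H"
  using assms(3)
proof (induction u)
  case Nil
  then show ?case using assms(1) by (simp add: subgroup.one_closed)
next
  case (Cons l u)
  then show ?case using assms(1,2)
    by (cases l) (auto simp: subgroup.m_closed subgroup.m_inv_closed Pi_iff)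
qed

lemma (in group) word_eval_inverse:
  assumes "f \<in> \<Gamma> \<rightarrow> carrier G" "u \<in> words \<Gamma>"
  shows "\<exists>v\<in>words \<Gamma>. word_eval G f v = inv (word_eval G f u)"
  using assms(2)
proof (induction u)
  case Nil
  then show ?case by (intro bexI[of _ "[]"]) simp_all
next
  case (Cons l u)
  obtain x where l: "l = Gen x \<or> l = Gen_inv x" by (cases l) auto
  define l' where "l' = (if l = Gen x then Gen_inv x else Gen x)"
  have x: "x \<in> \<Gamma>" and u: "u \<in> words \<Gamma>" using Cons.prems l by auto
  obtain v where v: "v \<in> words \<Gamma>" "word_eval G f v = inv (word_eval G f u)"
    using Cons.IH[OF u] by blast
  have fx: "f x \<in> carrier G" using x assms(1) by auto
  have l': "[l'] \<in> words \<Gamma>" using x by (auto simp: l'_def)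
  have "word_eval G f (v @ [l']) = inv (word_eval G f (l # u))"
    using l fx word_eval_closed[OF assms(1) u] word_eval_append[OF assms(1) v(1) l'] v(2)
    by (auto simp: l'_def inv_mult_group)
  then show ?case using v(1) l' by (intro bexI[of _ "v @ [l']"]) simp_all
qed

lemma (in group) word_eval_replicate:
  assumes "f a \<in> carrier G"
  shows "word_eval G f (replicate k (Gen a)) = f a [^] k"
proof (induction k)
  case (Suc k)
  then show ?case using assms nat_pow_Suc2[OF assms, of k] by simp
qed simp

text \<open>Central factors cancel from a commutator: if \<open>x = c d\<close> and
  \<open>y = c' d'\<close> with \<open>c\<close>, \<open>c'\<close> central, then the commutator of
  \<open>x\<close> and \<open>y\<close> equals that of \<open>d\<close> and \<open>d'\<close>, which
  lies in \<open>D\<close>.\<close>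

lemma (in group) derived_subset_if_central_times_subgroup:
  assumes D: "subgroup D G"
    and K_central: "\<And>c x. c \<in> K \<Longrightarrow> x \<in> carrier G \<Longrightarrow> c \<otimes> x = x \<otimes> c"
    and KA: "\<And>c. c \<in> K \<Longrightarrow> c \<in> carrier G"
    and decomp: "\<And>x. x \<in> carrier G \<Longrightarrow> \<exists>c\<in>K. \<exists>d\<in>D. x = c \<otimes> d"
  shows "derived G (carrier G) \<subseteq> D"
proof -
  have "derived_set G (carrier G) \<subseteq> D"
  proof
    fix w assume "w \<in> derived_set G (carrier G)"
    then obtain x y where xy: "x \<in> carrier G" "y \<in> carrier G"
      and w: "w = x \<otimes> y \<otimes> inv x \<otimes> inv y" by blast
    obtain c d where cd: "c \<in> K" "d \<in> D" "x = c \<otimes> d" using decomp[OF xy(1)] by blast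
    obtain c' d' where cd': "c' \<in> K" "d' \<in> D" "y = c' \<otimes> d'" using decomp[OF xy(2)] by blast
    have [simp]: "c \<in> carrier G" "c' \<in> carrier G" "d \<in> carrier G" "d' \<in> carrier G"
      using cd cd' KA subgroup.mem_carrier[OF D] by auto
    \<comment> \<open>Conjugation by \<open>x\<close> does not see the central factor
      \<open>c\<close>. Using this with \<open>t = y\<close> replaces \<open>x\<close> by
      \<open>d\<close> in the commutator before \<open>y\<close> is expanded.\<close>
    have xd: "x \<otimes> t \<otimes> inv x = d \<otimes> t \<otimes> inv d" if [simp]: "t \<in> carrier G" for t
    proof -
      have "x \<otimes> t \<otimes> inv x = c \<otimes> (d \<otimes> t \<otimes> inv d) \<otimes> inv c"
        by (simp add: cd(3) m_assoc inv_mult_group)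
      also have "\<dots> = d \<otimes> t \<otimes> inv d \<otimes> c \<otimes> inv c"
        using K_central[OF cd(1), of "d \<otimes> t \<otimes> inv d"] by simp
      also have "\<dots> = d \<otimes> t \<otimes> inv d" by (simp add: m_assoc)
      finally show ?thesis .
    qed
    have "w = d \<otimes> y \<otimes> inv d \<otimes> inv y" using xy by (simp add: w xd)
    also have "\<dots> = c' \<otimes> (d \<otimes> d' \<otimes> inv d \<otimes> inv d') \<otimes> inv c'"
    proof -
      have "d \<otimes> c' = c' \<otimes> d" using K_central[OF cd'(1), of d] by simp
      then show ?thesis by (simp add: cd'(3) inv_mult_group) (simp flip: m_assoc)
    qed
    also have "\<dots> = d \<otimes> d' \<otimes> inv d \<otimes> inv d' \<otimes> c' \<otimes> inv c'"
      using K_central[OF cd'(1), of "d \<otimes> d' \<otimes> inv d \<otimes> inv d'"] by simp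
    also have "\<dots> = d \<otimes> d' \<otimes> inv d \<otimes> inv d'" by (simp add: m_assoc)
    finally show "w \<in> D"
      using cd(2) cd'(2) D by (simp add: subgroup.m_closed subgroup.m_inv_closed)
  qed
  then show ?thesis
    unfolding derived_def using D by (rule generate_subgroup_incl)
qed

section \<open>Generation of presented groups and of the structure group\<close>

lemma word_eval_presented_group:
  assumes "u \<in> words \<Gamma>"
  shows "word_eval (presented_group \<Gamma> R) (\<lambda>x. pres_class \<Gamma> R [Gen x]) u = pres_class \<Gamma> R u"
  using assms
proof (induction u)
  case Nil
  then show ?case by (simp add: presented_group_def)
next
  case (Cons l u)
  let ?P = "presented_group \<Gamma> R"
  interpret P: group ?P by (rule group_presented_group)
  have l: "[l] \<in> words \<Gamma>" and u: "u \<in> words \<Gamma>" using Cons.prems by (cases l; simp)+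
  have "inv\<^bsub>?P\<^esub> (pres_class \<Gamma> R [Gen x]) = pres_class \<Gamma> R [Gen_inv x]" if x: "x \<in> \<Gamma>" for x
  proof (rule P.inv_equality)
    have "pres_class \<Gamma> R [Gen_inv x] \<otimes>\<^bsub>?P\<^esub> pres_class \<Gamma> R [Gen x] = pres_class \<Gamma> R []"
      using x by (simp add: presented_group_mult pres_class_eq_iff pres_cong.left_inv)
    then show "pres_class \<Gamma> R [Gen_inv x] \<otimes>\<^bsub>?P\<^esub> pres_class \<Gamma> R [Gen x] = \<one>\<^bsub>?P\<^esub>"
      by (simp add: presented_group_def)
  qed (use x in simp_all)
  then show ?case
    using Cons.IH[OF u] l presented_group_mult[OF l u, of R] by (cases l) simp_all
qed

text \<open>Serves as an induction principle: a property of all elements follows once the elements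
  having it form a subgroup that contains the generators. Every element is a word evaluated at
  generators, so it stays in such a subgroup.\<close>

lemma presented_group_subset_subgroup:
  assumes "subgroup H (presented_group \<Gamma> R)" "\<And>x. x \<in> \<Gamma> \<Longrightarrow> pres_class \<Gamma> R [Gen x] \<in> H"
  shows "carrier (presented_group \<Gamma> R) \<subseteq> H"
proof
  fix X assume "X \<in> carrier (presented_group \<Gamma> R)"
  then obtain u where u: "u \<in> words \<Gamma>" "X = pres_class \<Gamma> R u" by (rule presented_groupE)
  show "X \<in> H"
    using group.word_eval_subgroup[OF group_presented_group assms(1) _ u(1),
        of "\<lambda>x. pres_class \<Gamma> R [Gen x]"] assms(2) u
    by (auto simp: word_eval_presented_group)
qed

lemma group_structure_group: "group (structure_group G)"
  by (simp add: structure_group_def group_presented_group)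

lemma structure_gen_closed [simp]:
  "a \<in> carrier G \<Longrightarrow> structure_gen G a \<in> carrier (structure_group G)"
  by (simp add: structure_gen_def structure_group_def)

lemma structure_group_subset_subgroup:
  assumes "subgroup H (structure_group G)" "\<And>a. a \<in> carrier G \<Longrightarrow> structure_gen G a \<in> H"
  shows "carrier (structure_group G) \<subseteq> H"
  using presented_group_subset_subgroup assms
  unfolding structure_group_def structure_gen_def by blast

section \<open>The structure group of an arbitrary group: kernels of \<open>structure_pi\<close> and
  \<open>structure_Ab\<close>, and surjectivity\<close>

context group
begin

lemma group_hom_structure_pi: "group_hom (structure_group G) G (structure_pi G)"
  by (simp add: group_hom_def group_hom_axioms_def group_structure_group structure_pi_hom)

lemma group_hom_structure_Ab:
  "group_hom (structure_group G) (free_Abelian_group (conj_classes G)) (structure_Ab G)"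
  by (simp add: group_hom_def group_hom_axioms_def group_structure_group structure_Ab_hom)

lemma structure_gen_comm:
  assumes "a \<in> carrier G" "b \<in> carrier G"
  shows "structure_gen G a \<otimes>\<^bsub>structure_group G\<^esub> structure_gen G b =
    structure_gen G b \<otimes>\<^bsub>structure_group G\<^esub> structure_gen G (inv b \<otimes> a \<otimes> b)"
proof -
  let ?R = "structure_relations G"
  have "pres_cong (carrier G) ?R [Gen a, Gen b] [Gen b, Gen (inv b \<otimes> a \<otimes> b)]"
    by (rule pres_cong.rel) (use assms in \<open>auto simp: structure_relations_def\<close>)
  then show ?thesis
    using assms unfolding structure_group_def structure_gen_def
    by (simp add: presented_group_mult pres_class_eq_iff)
qed

text \<open>For a generator \<open>z\<close> this is a defining relation. The elements
  \<open>z\<close> that satisfy it form a subgroup, because \<open>structure_pi\<close> is a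
  homomorphism.\<close>

lemma structure_gen_conj:
  assumes a: "a \<in> carrier G" and z: "z \<in> carrier (structure_group G)"
  shows "structure_gen G a \<otimes>\<^bsub>structure_group G\<^esub> z =
    z \<otimes>\<^bsub>structure_group G\<^esub> structure_gen G (inv (structure_pi G z) \<otimes> a \<otimes> structure_pi G z)"
proof -
  let ?A = "structure_group G" and ?p = "structure_pi G" and ?e = "structure_gen G"
  interpret A: group ?A by (rule group_structure_group)
  interpret p: group_hom ?A G ?p by (rule group_hom_structure_pi)
  \<comment> \<open>The quantifier over \<open>a\<close> stays inside the set: moving a generator
    past a product or an inverse changes its index, so the identity for \<open>z\<close> is needed
    at other indices as well.\<close>
  let ?H = "{z \<in> carrier ?A. \<forall>a\<in>carrier G. ?e a \<otimes>\<^bsub>?A\<^esub> z = z \<otimes>\<^bsub>?A\<^esub> ?e (inv (?p z) \<otimes> a \<otimes> ?p z)}"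
  have "subgroup ?H ?A"
  proof (rule A.subgroupI)
    show "?H \<subseteq> carrier ?A" by auto
    have "\<one>\<^bsub>?A\<^esub> \<in> ?H" by auto
    then show "?H \<noteq> {}" by blast
  next
    fix x assume "x \<in> ?H"
    then have x: "x \<in> carrier ?A"
      and eq: "\<And>a. a \<in> carrier G \<Longrightarrow> ?e a \<otimes>\<^bsub>?A\<^esub> x = x \<otimes>\<^bsub>?A\<^esub> ?e (inv (?p x) \<otimes> a \<otimes> ?p x)" by auto
    have "?e a \<otimes>\<^bsub>?A\<^esub> inv\<^bsub>?A\<^esub> x = inv\<^bsub>?A\<^esub> x \<otimes>\<^bsub>?A\<^esub> ?e (?p x \<otimes> a \<otimes> inv (?p x))"
      if a: "a \<in> carrier G" for a
    proof -
      \<comment> \<open>The index is chosen so that conjugating it by \<open>?p x\<close> gives back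
        \<open>a\<close>; then \<open>eq\<close> at \<open>?b\<close> can be solved for
        \<open>?e a\<close>.\<close>
      let ?b = "?p x \<otimes> a \<otimes> inv (?p x)"
      have b: "?b \<in> carrier G" using a x by simp
      have "inv (?p x) \<otimes> ?b \<otimes> ?p x = a"
        using a x by (simp add: m_assoc) (simp flip: m_assoc)
      then have "?e ?b \<otimes>\<^bsub>?A\<^esub> x = x \<otimes>\<^bsub>?A\<^esub> ?e a" using eq[OF b] by simp
      then have "?e a = inv\<^bsub>?A\<^esub> x \<otimes>\<^bsub>?A\<^esub> (?e ?b \<otimes>\<^bsub>?A\<^esub> x)"
        using a b x by (simp add: A.inv_solve_left)
      then show ?thesis using a b x by (simp add: A.m_assoc)
    qed
    then show "inv\<^bsub>?A\<^esub> x \<in> ?H" using x by simp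
    fix y assume "y \<in> ?H"
    then have y: "y \<in> carrier ?A"
      and eq': "\<And>a. a \<in> carrier G \<Longrightarrow> ?e a \<otimes>\<^bsub>?A\<^esub> y = y \<otimes>\<^bsub>?A\<^esub> ?e (inv (?p y) \<otimes> a \<otimes> ?p y)" by auto
    have "?e a \<otimes>\<^bsub>?A\<^esub> (x \<otimes>\<^bsub>?A\<^esub> y) =
        (x \<otimes>\<^bsub>?A\<^esub> y) \<otimes>\<^bsub>?A\<^esub> ?e (inv (?p (x \<otimes>\<^bsub>?A\<^esub> y)) \<otimes> a \<otimes> ?p (x \<otimes>\<^bsub>?A\<^esub> y))"
      if a: "a \<in> carrier G" for a
    proof -
      let ?b = "inv (?p x) \<otimes> a \<otimes> ?p x"
      have b: "?b \<in> carrier G" using a x by simp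
      have "?e a \<otimes>\<^bsub>?A\<^esub> (x \<otimes>\<^bsub>?A\<^esub> y) = x \<otimes>\<^bsub>?A\<^esub> (?e ?b \<otimes>\<^bsub>?A\<^esub> y)"
        using a b x y eq[OF a] by (simp flip: A.m_assoc)
      also have "\<dots> = (x \<otimes>\<^bsub>?A\<^esub> y) \<otimes>\<^bsub>?A\<^esub> ?e (inv (?p y) \<otimes> ?b \<otimes> ?p y)"
        using b x y eq'[OF b] by (simp add: A.m_assoc)
      also have "inv (?p y) \<otimes> ?b \<otimes> ?p y = inv (?p (x \<otimes>\<^bsub>?A\<^esub> y)) \<otimes> a \<otimes> ?p (x \<otimes>\<^bsub>?A\<^esub> y)"
        using a x y by (simp add: m_assoc inv_mult_group)
      finally show ?thesis .
    qed
    then show "x \<otimes>\<^bsub>?A\<^esub> y \<in> ?H" using x y by simp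
  qed
  then have "carrier ?A \<subseteq> ?H"
    by (rule structure_group_subset_subgroup) (simp add: structure_pi_gen, metis structure_gen_comm)
  then show ?thesis using a z by blast
qed

text \<open>When \<open>structure_pi G c\<close> is trivial, \<open>structure_gen_conj\<close> says
  that \<open>c\<close> commutes with every generator. The centraliser of \<open>c\<close> is a
  subgroup, so it is everything.\<close>

lemma structure_pi_kernel_central:
  assumes c: "c \<in> kernel (structure_group G) G (structure_pi G)"
    and z: "z \<in> carrier (structure_group G)"
  shows "c \<otimes>\<^bsub>structure_group G\<^esub> z = z \<otimes>\<^bsub>structure_group G\<^esub> c"
proof -
  let ?A = "structure_group G"
  interpret A: group ?A by (rule group_structure_group)
  have cA [simp]: "c \<in> carrier ?A" and pc: "structure_pi G c = \<one>" using c by (auto simp: kernel_def)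
  let ?H = "{z \<in> carrier ?A. c \<otimes>\<^bsub>?A\<^esub> z = z \<otimes>\<^bsub>?A\<^esub> c}"
  have "subgroup ?H ?A"
  proof (rule A.subgroupI)
    show "?H \<subseteq> carrier ?A" by auto
    have "\<one>\<^bsub>?A\<^esub> \<in> ?H" by auto
    then show "?H \<noteq> {}" by blast
  next
    fix x assume "x \<in> ?H"
    then have x: "x \<in> carrier ?A" and eq: "c \<otimes>\<^bsub>?A\<^esub> x = x \<otimes>\<^bsub>?A\<^esub> c" by auto
    have "c = inv\<^bsub>?A\<^esub> x \<otimes>\<^bsub>?A\<^esub> (c \<otimes>\<^bsub>?A\<^esub> x)" using x eq by (simp flip: A.m_assoc)
    then have "c \<otimes>\<^bsub>?A\<^esub> inv\<^bsub>?A\<^esub> x = inv\<^bsub>?A\<^esub> x \<otimes>\<^bsub>?A\<^esub> c \<otimes>\<^bsub>?A\<^esub> x \<otimes>\<^bsub>?A\<^esub> inv\<^bsub>?A\<^esub> x"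
      using x by (simp add: A.m_assoc)
    then show "inv\<^bsub>?A\<^esub> x \<in> ?H" using x by (simp add: A.m_assoc)
    fix y assume "y \<in> ?H"
    then have y: "y \<in> carrier ?A" and eq': "c \<otimes>\<^bsub>?A\<^esub> y = y \<otimes>\<^bsub>?A\<^esub> c" by auto
    have "c \<otimes>\<^bsub>?A\<^esub> (x \<otimes>\<^bsub>?A\<^esub> y) = x \<otimes>\<^bsub>?A\<^esub> (c \<otimes>\<^bsub>?A\<^esub> y)" using x y eq by (simp flip: A.m_assoc)
    then show "x \<otimes>\<^bsub>?A\<^esub> y \<in> ?H" using x y eq' by (simp add: A.m_assoc)
  qed
  then have "carrier ?A \<subseteq> ?H"
    by (rule structure_group_subset_subgroup) (simp add: structure_gen_conj pc)
  then show ?thesis using z by blast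
qed

text \<open>The quotient map of the structure group onto its abelianisation factors through
  \<open>structure_Ab\<close>: a homomorphism \<open>h\<close> back from the free abelian group is
  built so that \<open>h \<circ> structure_Ab G\<close> agrees with the quotient map on generators.
  An element killed by \<open>structure_Ab\<close> is therefore trivial in the
  abelianisation.\<close>

lemma structure_Ab_kernel:
  assumes z: "z \<in> carrier (structure_group G)" and Ab: "structure_Ab G z = 0"
  shows "z \<in> derived (structure_group G) (carrier (structure_group G))"
proof -
  let ?A = "structure_group G" and ?e = "structure_gen G" and ?Z = "free_Abelian_group (conj_classes G)"
  interpret A: group ?A by (rule group_structure_group)
  interpret B: comm_group "abelianisation ?A" by (rule A.comm_group_abelianisation)
  interpret q: group_hom ?A "abelianisation ?A" "ab_map ?A"
    by unfold_locales (rule A.ab_map_hom)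
  define f where "f Q = ab_map ?A (?e (SOME a. a \<in> Q))" for Q
  have f: "f (conj_class G a) = ab_map ?A (?e a)" if a: "a \<in> carrier G" for a
  proof -
    have "(SOME b. b \<in> conj_class G a) \<in> conj_class G a"
      using conj_class_self[OF a] by (rule someI)
    then obtain g where g: "g \<in> carrier G" and eq: "(SOME b. b \<in> conj_class G a) = inv g \<otimes> a \<otimes> g"
      by (auto simp: conj_class_def)
    \<comment> \<open>The relation between \<open>a\<close> and \<open>g\<close>, read in an abelian
      group: cancelling the image of \<open>?e g\<close> shows that conjugate indices give the same
      element, so \<open>f\<close> does not depend on the representative picked by
      \<open>SOME\<close>.\<close>
    have "ab_map ?A (?e g) \<otimes>\<^bsub>abelianisation ?A\<^esub> ab_map ?A (?e (inv g \<otimes> a \<otimes> g)) =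
        ab_map ?A (?e g) \<otimes>\<^bsub>abelianisation ?A\<^esub> ab_map ?A (?e a)"
      using structure_gen_comm[OF a g, THEN arg_cong[of _ _ "ab_map ?A"]] a g by (simp add: B.m_comm)
    then show ?thesis using a g by (simp add: f_def eq)
  qed
  have "f ` conj_classes G \<subseteq> carrier (abelianisation ?A)"
    by (auto simp: conj_classes_def f)
  then obtain h where h: "h \<in> hom ?Z (abelianisation ?A)"
    and hf: "\<And>Q. Q \<in> conj_classes G \<Longrightarrow> h (frag_of Q) = f Q"
    by (rule B.free_Abelian_group_universal) auto
  interpret h: group_hom ?Z "abelianisation ?A" h
    using h by (simp add: group_hom_def group_hom_axioms_def B.is_group)
  have "(h \<circ> structure_Ab G) z = ab_map ?A z"
  proof (rule B.presented_group_hom_unique)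
    show "h \<circ> structure_Ab G
        \<in> hom (presented_group (carrier G) (structure_relations G)) (abelianisation ?A)"
      using Group.hom_compose[OF structure_Ab_hom h] by (simp add: structure_group_def)
    show "ab_map ?A \<in> hom (presented_group (carrier G) (structure_relations G)) (abelianisation ?A)"
      using A.ab_map_hom by (simp add: structure_group_def)
    show "z \<in> carrier (presented_group (carrier G) (structure_relations G))"
      using z by (simp add: structure_group_def)
    fix a assume a: "a \<in> carrier G"
    then show "(h \<circ> structure_Ab G) (pres_class (carrier G) (structure_relations G) [Gen a]) =
        ab_map ?A (pres_class (carrier G) (structure_relations G) [Gen a])"
      using structure_Ab_gen[OF a] f[OF a] hf by (simp add: structure_gen_def conj_classes_def)
  qed
  then have "ab_map ?A z = derived ?A (carrier ?A)"
    using Ab h.hom_one by (simp add: abelianisation_def FactGroup_def)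
  moreover have "z \<in> ab_map ?A z"
    unfolding ab_map_def using A.rcos_self[OF z] A.derived_is_subgroup by simp
  ultimately show ?thesis by simp
qed

lemma structure_Ab_surj:
  assumes "x \<in> carrier (free_Abelian_group (conj_classes G))"
  shows "\<exists>z\<in>carrier (structure_group G). structure_Ab G z = x"
proof -
  let ?A = "structure_group G"
  interpret A: group ?A by (rule group_structure_group)
  interpret Ab: group_hom ?A "free_Abelian_group (conj_classes G)" "structure_Ab G"
    by (rule group_hom_structure_Ab)
  have "Poly_Mapping.keys x \<subseteq> conj_classes G" using assms by simp
  then show ?thesis
  proof (rule free_Abelian_group_induct)
    show "\<exists>z\<in>carrier ?A. structure_Ab G z = 0"
      using Ab.hom_one by (intro bexI[of _ "\<one>\<^bsub>?A\<^esub>"]) simp_all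
  next
    fix x y
    assume "\<exists>z\<in>carrier ?A. structure_Ab G z = x" "\<exists>z\<in>carrier ?A. structure_Ab G z = y"
    then obtain z w where zw: "z \<in> carrier ?A" "w \<in> carrier ?A"
      and eq: "structure_Ab G z = x" "structure_Ab G w = y" by blast
    have "structure_Ab G w \<in> carrier (free_Abelian_group (conj_classes G))"
      by (rule Ab.hom_closed[OF zw(2)])
    then have "structure_Ab G (z \<otimes>\<^bsub>?A\<^esub> inv\<^bsub>?A\<^esub> w) = x - y" using zw eq by simp
    then show "\<exists>z\<in>carrier ?A. structure_Ab G z = x - y" using zw by blast
  next
    fix Q assume "Q \<in> conj_classes G"
    then obtain a where a: "a \<in> carrier G" "Q = conj_class G a" by (auto simp: conj_classes_def)
    then show "\<exists>z\<in>carrier ?A. structure_Ab G z = frag_of Q"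
      by (intro bexI[of _ "structure_gen G a"]) (simp_all add: structure_Ab_gen)
  qed
qed

lemma structure_Ab_derived:
  assumes "z \<in> derived (structure_group G) (carrier (structure_group G))"
  shows "structure_Ab G z = 0"
proof -
  let ?Z = "free_Abelian_group (conj_classes G)"
  interpret Ab: group_hom "structure_group G" ?Z "structure_Ab G" by (rule group_hom_structure_Ab)
  interpret Z: comm_group ?Z by (rule abelian_free_Abelian_group)
  have "structure_Ab G z \<in> derived ?Z (structure_Ab G ` carrier (structure_group G))"
    using assms Ab.derived_img[of "carrier (structure_group G)"] by blast
  moreover have "structure_Ab G ` carrier (structure_group G) \<subseteq> carrier ?Z"
    using Ab.hom_closed by blast
  ultimately show ?thesis using Z.derived_eq_singleton by auto
qed

text \<open>Any preimage of \<open>x\<close> under \<open>structure_Ab\<close> has a first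
  coordinate that differs from \<open>a\<close> by an element of the derived subgroup of
  \<open>G\<close>. This element lifts to the derived subgroup of the structure group, where the
  correction leaves \<open>structure_Ab\<close> unchanged.\<close>

lemma fibre_product_surj:
  assumes a: "a \<in> carrier G" and x: "x \<in> carrier (free_Abelian_group (conj_classes G))"
    and eq: "ab_map G a = pi_bar G x"
  shows "\<exists>z\<in>carrier (structure_group G). structure_pi G z = a \<and> structure_Ab G z = x"
proof -
  let ?A = "structure_group G" and ?p = "structure_pi G"
  interpret A: group ?A by (rule group_structure_group)
  interpret p: group_hom ?A G ?p by (rule group_hom_structure_pi)
  interpret Ab: group_hom ?A "free_Abelian_group (conj_classes G)" "structure_Ab G"
    by (rule group_hom_structure_Ab)
  obtain z where z: "z \<in> carrier ?A" "structure_Ab G z = x" using structure_Ab_surj[OF x] by blast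
  have p_surj: "?p ` carrier ?A = carrier G"
    using structure_pi_gen structure_gen_closed p.hom_closed
    by (metis subsetI image_eqI image_subsetI subset_antisym)
  \<comment> \<open>Commutativity of the square gives \<open>ab_map G a = ab_map G (?p z)\<close> as
    cosets, and \<open>a\<close> lies in its own coset.\<close>
  have "a \<in> derived G (carrier G) #> ?p z"
    using rcos_self[OF a derived_is_subgroup[OF subset_refl]] eq z pi_bar_structure_Ab[OF z(1)]
    by (simp add: ab_map_def)
  then obtain d where d: "d \<in> derived G (carrier G)" "a = d \<otimes> ?p z" by (auto simp: r_coset_def)
  then obtain w where w: "w \<in> derived ?A (carrier ?A)" "?p w = d"
    using p.derived_img[of "carrier ?A"] p_surj by auto
  have wA: "w \<in> carrier ?A" using w(1) A.derived_in_carrier by blast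
  show ?thesis
    using z wA w d structure_Ab_derived[OF w(1)] by (intro bexI[of _ "w \<otimes>\<^bsub>?A\<^esub> z"]) simp_all
qed

end

section \<open>Injectivity for C-bar groups\<close>

lemma power_relation_inject:
  assumes "power_relation a k = power_relation b l" "k \<ge> 2"
  shows "a = b \<and> k = l"
  \<comment> \<open>For \<open>k = 0\<close> both words of the relation would be empty and
    \<open>a\<close> could not be recovered.\<close>
  using assms by (auto simp: power_relation_def)

lemma (in group) Cbar_kernel_trivial:
  assumes Cbar: "Cbar_group TYPE('g) G"
    and z: "z \<in> carrier (structure_group G)"
    and pi_z: "structure_pi G z = \<one>" and Ab_z: "structure_Ab G z = 0"
  shows "z = \<one>\<^bsub>structure_group G\<^esub>"
proof -
  let ?A = "structure_group G" and ?p = "structure_pi G" and ?Ab = "structure_Ab G"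
  obtain \<Gamma> :: "'g set" and R \<phi> where
    R: "\<forall>r\<in>R. (\<exists>a\<in>\<Gamma>. \<exists>b\<in>\<Gamma>. \<exists>c\<in>\<Gamma>. r = conj_relation a b c) \<or>
              (\<exists>a\<in>\<Gamma>. \<exists>k\<ge>2. r = power_relation a k)" and
    \<phi>: "\<phi> \<in> iso (presented_group \<Gamma> R) G" and
    unique: "\<forall>Q\<in>conj_classes G. \<exists>\<^sub>\<le>\<^sub>1 r. r \<in> R \<and>
        (\<exists>a\<in>\<Gamma>. \<exists>k\<ge>2. r = power_relation a k \<and> \<phi> (pres_class \<Gamma> R [Gen a]) \<in> Q)"
    using Cbar unfolding Cbar_group_def by (elim conjE exE)
  interpret A: group ?A by (rule group_structure_group)
  interpret p: group_hom ?A G ?p by (rule group_hom_structure_pi)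
  interpret Ab: group_hom ?A "free_Abelian_group (conj_classes G)" ?Ab
    by (rule group_hom_structure_Ab)
  interpret \<phi>: group_hom "presented_group \<Gamma> R" G \<phi>
    using \<phi> by (simp add: group_hom_def group_hom_axioms_def group_presented_group iso_def)
  \<comment> \<open>Here \<open>g x\<close> is the element of \<open>G\<close> that the symbol
    \<open>x\<close> represents, \<open>e x\<close> the structure generator at that element, and
    \<open>E\<close> the evaluation of words in the structure group. \<open>E\<close> need not
    respect the power relations, so it is kept as a map on words.\<close>
  define g where "g x = \<phi> (pres_class \<Gamma> R [Gen x])" for x
  define e where "e x = structure_gen G (g x)" for x
  define E where "E = word_eval ?A e"
  have g [simp]: "g x \<in> carrier G" if "x \<in> \<Gamma>" for x using that by (simp add: g_def)
  have e [simp]: "e x \<in> carrier ?A" if "x \<in> \<Gamma>" for x using that by (simp add: e_def)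
  have e_Pi: "e \<in> \<Gamma> \<rightarrow> carrier ?A" by simp
  have E_closed [simp]: "E u \<in> carrier ?A" if "u \<in> words \<Gamma>" for u
    unfolding E_def using A.word_eval_closed[OF e_Pi that] .
  have E_append: "E (u @ v) = E u \<otimes>\<^bsub>?A\<^esub> E v" if "u \<in> words \<Gamma>" "v \<in> words \<Gamma>" for u v
    unfolding E_def using A.word_eval_append[OF e_Pi that] .
  have eval_g: "word_eval G g u = \<phi> (pres_class \<Gamma> R u)" if u: "u \<in> words \<Gamma>" for u
  proof -
    have "\<phi> (pres_class \<Gamma> R u) = word_eval G (\<phi> \<circ> (\<lambda>x. pres_class \<Gamma> R [Gen x])) u"
      using \<phi>.hom_word_eval[of "\<lambda>x. pres_class \<Gamma> R [Gen x]" \<Gamma> u] u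
      by (simp add: word_eval_presented_group)
    then show ?thesis by (simp add: g_def[abs_def] comp_def)
  qed
  have pi_E: "?p (E u) = \<phi> (pres_class \<Gamma> R u)" if u: "u \<in> words \<Gamma>" for u
  proof -
    have eval_eq: "word_eval G (?p \<circ> e) u = word_eval G g u"
      using u
    proof (induction u)
      case (Cons l u)
      then show ?case by (cases l) (simp_all add: e_def structure_pi_gen)
    qed simp
    then show ?thesis
      unfolding E_def using p.hom_word_eval[OF e_Pi u] eval_g[OF u] by simp
  qed
  define K where "K = kernel ?A G ?p"
  have K: "subgroup K ?A" unfolding K_def by (rule p.subgroup_kernel)
  have K_central: "c \<otimes>\<^bsub>?A\<^esub> x = x \<otimes>\<^bsub>?A\<^esub> c" if "c \<in> K" "x \<in> carrier ?A" for c x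
    using structure_pi_kernel_central that unfolding K_def by blast
  have KA: "c \<in> carrier ?A" if "c \<in> K" for c using that K by (rule subgroup.mem_carrier[rotated])

  define pw where "pw Q a k \<longleftrightarrow> a \<in> \<Gamma> \<and> k \<ge> 2 \<and> power_relation a k \<in> R \<and> g a \<in> Q" for Q a k
  \<comment> \<open>The hypothesis makes the relation unique as a pair of words;
    \<open>power_relation_inject\<close> recovers symbol and exponent from it.\<close>
  have pw_unique: "a = b \<and> k = l" if "Q \<in> conj_classes G" "pw Q a k" "pw Q b l" for Q a b k l
  proof (rule power_relation_inject)
    show "power_relation a k = power_relation b l"
      by (rule Uniq_D[OF bspec[OF unique that(1)]])
        (use that(2,3) in \<open>auto simp: pw_def g_def\<close>)
  qed (use that in \<open>simp add: pw_def\<close>)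
  \<comment> \<open>\<open>T\<close> collects the classes that carry a power relation;
    \<open>\<alpha> Q\<close> and \<open>\<kappa> Q\<close> are the symbol and the exponent of that
    relation, and \<open>q Q\<close> below is its left-hand side evaluated in the structure
    group.\<close>
  define T where "T = {Q \<in> conj_classes G. \<exists>a k. pw Q a k}"
  define \<alpha> where "\<alpha> Q = (SOME a. \<exists>k. pw Q a k)" for Q
  define \<kappa> where "\<kappa> Q = (SOME k. pw Q (\<alpha> Q) k)" for Q
  have pw: "pw Q (\<alpha> Q) (\<kappa> Q)" if "Q \<in> T" for Q
  proof -
    have "\<exists>a k. pw Q a k" using that by (simp add: T_def)
    then have "\<exists>k. pw Q (\<alpha> Q) k" unfolding \<alpha>_def by (rule someI_ex)
    then show ?thesis unfolding \<kappa>_def by (rule someI_ex)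
  qed
  define q where "q Q = e (\<alpha> Q) [^]\<^bsub>?A\<^esub> \<kappa> Q" for Q
  have q_eq: "q (conj_class G (g a)) = e a [^]\<^bsub>?A\<^esub> k" and q_T: "conj_class G (g a) \<in> T"
    if "a \<in> \<Gamma>" "k \<ge> 2" "power_relation a k \<in> R" for a k
  proof -
    let ?Q = "conj_class G (g a)"
    have Q: "?Q \<in> conj_classes G" "pw ?Q a k"
      using that by (simp_all add: conj_classes_def pw_def conj_class_self)
    then show T: "?Q \<in> T" by (auto simp: T_def)
    show "q ?Q = e a [^]\<^bsub>?A\<^esub> k" using pw_unique[OF Q pw[OF T]] by (simp add: q_def)
  qed
  have q_K: "q Q \<in> K" if "Q \<in> T" for Q
  proof -
    let ?a = "\<alpha> Q" and ?k = "\<kappa> Q"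
    have a: "?a \<in> \<Gamma>" and rel: "power_relation ?a ?k \<in> R" using pw[OF that] by (auto simp: pw_def)
    have w: "replicate ?k (Gen ?a) \<in> words \<Gamma>" using a by (auto simp: words_def)
    have "pres_cong \<Gamma> R (replicate ?k (Gen ?a)) []"
      using rel w by (intro pres_cong.rel) (simp_all add: power_relation_def)
    \<comment> \<open>The power word is trivial in the presented group, hence in \<open>G\<close>,
      and by \<open>pi_E\<close> its image there is also the image of \<open>q Q\<close> under
      \<open>?p\<close>.\<close>
    then have "\<phi> (pres_class \<Gamma> R (replicate ?k (Gen ?a))) = \<phi> (\<one>\<^bsub>presented_group \<Gamma> R\<^esub>)"
      using w by (simp add: presented_group_def pres_class_eq_iff[THEN iffD2])
    then have "?p (E (replicate ?k (Gen ?a))) = \<one>" using pi_E[OF w] by simp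
    moreover have "E (replicate ?k (Gen ?a)) = q Q"
      unfolding E_def q_def using a by (simp add: A.word_eval_replicate)
    ultimately show ?thesis using E_closed[OF w] by (simp add: K_def kernel_def)
  qed
  have Ab_q: "?Ab (q Q) = frag_cmul (int (\<kappa> Q)) (frag_of Q)" if "Q \<in> T" for Q
  proof -
    have a: "\<alpha> Q \<in> \<Gamma>" "g (\<alpha> Q) \<in> Q" and Q: "Q \<in> conj_classes G"
      using pw[OF that] that by (auto simp: pw_def T_def)
    obtain b where b: "b \<in> carrier G" "Q = conj_class G b" using Q by (auto simp: conj_classes_def)
    then obtain t where "t \<in> carrier G" "g (\<alpha> Q) = inv t \<otimes> b \<otimes> t"
      using a(2) by (auto simp: conj_class_def)
    then have "conj_class G (g (\<alpha> Q)) = Q" using b conj_class_conj by simp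
    then show ?thesis
      using a by (simp add: q_def Ab.hom_nat_pow e_def structure_Ab_gen)
  qed

  \<comment> \<open>The universal property of the free abelian group needs a commutative target.
    Being central, the kernel \<open>K\<close> is one, so \<open>h\<close> is first built into
    \<open>K\<close> and then viewed as a map into \<open>?A\<close>; its image \<open>N\<close> is
    generated by the elements \<open>q Q\<close>.\<close>
  let ?K = "?A\<lparr>carrier := K\<rparr>" and ?T = "free_Abelian_group T"
  have "group ?K" using K by (rule A.subgroup_imp_group)
  then interpret K: comm_group ?K
    by (rule group.group_comm_groupI) (simp add: K_central KA)
  have "q ` T \<subseteq> carrier ?K" using q_K by auto
  then obtain h where h: "h \<in> hom ?T ?K" and hq: "\<And>Q. Q \<in> T \<Longrightarrow> h (frag_of Q) = q Q"
    by (rule K.free_Abelian_group_universal) auto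
  have "h \<in> hom ?T ?A" using h KA by (auto simp: hom_def)
  then interpret h: group_hom ?T ?A h by (simp add: group_hom_def group_hom_axioms_def A.is_group)
  define N where "N = h ` carrier ?T"
  have N: "subgroup N ?A" unfolding N_def by (rule h.img_is_subgroup)
  have NK: "N \<subseteq> K" using h by (auto simp: N_def hom_def)
  \<comment> \<open>In coordinates, \<open>?Ab \<circ> h\<close> is diagonal with entries
    \<open>\<kappa> Q\<close>. Outside \<open>T\<close> the value of \<open>\<kappa> Q\<close> is
    arbitrary, but there the coordinate of \<open>x\<close> is zero.\<close>
  have lookup_Ab_h: "poly_mapping.lookup (?Ab (h x)) Q = int (\<kappa> Q) * poly_mapping.lookup x Q"
    if "Poly_Mapping.keys x \<subseteq> T" for x Q
    using that
  proof (rule free_Abelian_group_induct)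
    show "poly_mapping.lookup (?Ab (h 0)) Q = int (\<kappa> Q) * poly_mapping.lookup 0 Q"
      using h.hom_one Ab.hom_one by simp
  next
    fix x y assume xy: "Poly_Mapping.keys x \<subseteq> T" "Poly_Mapping.keys y \<subseteq> T"
      and IH: "poly_mapping.lookup (?Ab (h x)) Q = int (\<kappa> Q) * poly_mapping.lookup x Q"
        "poly_mapping.lookup (?Ab (h y)) Q = int (\<kappa> Q) * poly_mapping.lookup y Q"
    have c: "x \<in> carrier ?T" "y \<in> carrier ?T" using xy by simp_all
    have "x - y = x \<otimes>\<^bsub>?T\<^esub> inv\<^bsub>?T\<^esub> y" using xy by simp
    then have "h (x - y) = h x \<otimes>\<^bsub>?A\<^esub> inv\<^bsub>?A\<^esub> h y"
      using c by (simp only: h.hom_mult h.hom_inv h.G.inv_closed)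
    moreover have "?Ab (h y) \<in> carrier (free_Abelian_group (conj_classes G))"
      using c h.hom_closed Ab.hom_closed by blast
    ultimately have "?Ab (h (x - y)) = ?Ab (h x) - ?Ab (h y)"
      using h.hom_closed[OF c(1)] h.hom_closed[OF c(2)] by simp
    then show "poly_mapping.lookup (?Ab (h (x - y))) Q = int (\<kappa> Q) * poly_mapping.lookup (x - y) Q"
      using IH by (simp add: lookup_minus right_diff_distrib)
  next
    fix Q' assume "Q' \<in> T"
    then show "poly_mapping.lookup (?Ab (h (frag_of Q'))) Q =
        int (\<kappa> Q) * poly_mapping.lookup (frag_of Q') Q"
      by (simp add: hq Ab_q)
  qed
  have N_Ab: "n = \<one>\<^bsub>?A\<^esub>" if n: "n \<in> N" and "?Ab n = 0" for n
  proof -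
    obtain x where x: "Poly_Mapping.keys x \<subseteq> T" "n = h x" using n by (auto simp: N_def)
    have "poly_mapping.lookup x Q = 0" for Q
    proof (cases "Q \<in> T")
      case True
      \<comment> \<open>A nonzero exponent can be cancelled in the integers, which makes
        \<open>?Ab\<close> injective on \<open>N\<close>.\<close>
      then have "\<kappa> Q \<ge> 2" using pw by (simp add: pw_def)
      then show ?thesis using lookup_Ab_h[OF x(1), of Q] x(2) that(2) by simp
    next
      case False
      then show ?thesis using x(1) by (auto simp: in_keys_iff)
    qed
    then have "x = 0" by (simp add: poly_mapping_eqI)
    then show ?thesis using x(2) h.hom_one by simp
  qed

  \<comment> \<open>Congruent words have the same image up to a factor from \<open>N\<close>.
    Centrality of \<open>N\<close> enters in the case of concatenation, where \<open>m\<close> has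
    to pass \<open>E u'\<close>.\<close>
  have N_cong: "\<exists>n\<in>N. E u = n \<otimes>\<^bsub>?A\<^esub> E v" if "pres_cong \<Gamma> R u v" for u v
    using that
  proof (induction rule: pres_cong.induct)
    case (refl u)
    then show ?case using subgroup.one_closed[OF N] by (intro bexI[of _ "\<one>\<^bsub>?A\<^esub>"]) simp_all
  next
    case (sym u v)
    then obtain n where n: "n \<in> N" "E u = n \<otimes>\<^bsub>?A\<^esub> E v" by blast
    have w: "u \<in> words \<Gamma>" "v \<in> words \<Gamma>" using pres_cong_words[OF sym(1)] by auto
    have "E v = inv\<^bsub>?A\<^esub> n \<otimes>\<^bsub>?A\<^esub> E u"
      using n w KA[OF subsetD[OF NK n(1)]] by (simp flip: A.m_assoc)
    then show ?case using n(1) subgroup.m_inv_closed[OF N] by blast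
  next
    case (trans u v w)
    then obtain n m where nm: "n \<in> N" "m \<in> N" and eq: "E u = n \<otimes>\<^bsub>?A\<^esub> E v" "E v = m \<otimes>\<^bsub>?A\<^esub> E w" by blast
    have w: "w \<in> words \<Gamma>" using pres_cong_words[OF trans(2)] by auto
    have "E u = n \<otimes>\<^bsub>?A\<^esub> m \<otimes>\<^bsub>?A\<^esub> E w"
      using eq w KA[OF subsetD[OF NK nm(1)]] KA[OF subsetD[OF NK nm(2)]] by (simp add: A.m_assoc)
    then show ?case using nm subgroup.m_closed[OF N] by blast
  next
    case (append u u' v v')
    then obtain n m where nm: "n \<in> N" "m \<in> N"
      and eq: "E u = n \<otimes>\<^bsub>?A\<^esub> E u'" "E v = m \<otimes>\<^bsub>?A\<^esub> E v'" by blast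
    have w: "u \<in> words \<Gamma>" "u' \<in> words \<Gamma>" "v \<in> words \<Gamma>" "v' \<in> words \<Gamma>"
      using pres_cong_words[OF append(1)] pres_cong_words[OF append(2)] by auto
    have nmA [simp]: "n \<in> carrier ?A" "m \<in> carrier ?A" using nm KA NK by auto
    have "E (u @ v) = n \<otimes>\<^bsub>?A\<^esub> (E u' \<otimes>\<^bsub>?A\<^esub> m) \<otimes>\<^bsub>?A\<^esub> E v'"
      using eq w by (simp add: E_append A.m_assoc)
    also have "E u' \<otimes>\<^bsub>?A\<^esub> m = m \<otimes>\<^bsub>?A\<^esub> E u'" using K_central nm NK w by (metis E_closed subsetD)
    finally have "E (u @ v) = n \<otimes>\<^bsub>?A\<^esub> m \<otimes>\<^bsub>?A\<^esub> E (u' @ v')"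
      using w by (simp add: E_append A.m_assoc)
    then show ?case using nm subgroup.m_closed[OF N] by blast
  next
    case (right_inv x)
    then show ?case using subgroup.one_closed[OF N]
      by (intro bexI[of _ "\<one>\<^bsub>?A\<^esub>"]) (simp_all add: E_def)
  next
    case (left_inv x)
    then show ?case using subgroup.one_closed[OF N]
      by (intro bexI[of _ "\<one>\<^bsub>?A\<^esub>"]) (simp_all add: E_def)
  next
    case (rel u v)
    consider (conj) a b c where "a \<in> \<Gamma>" "b \<in> \<Gamma>" "c \<in> \<Gamma>" "(u, v) = conj_relation a b c"
      | (power) a k where "a \<in> \<Gamma>" "k \<ge> 2" "(u, v) = power_relation a k"
      using bspec[OF R rel(1)] by blast
    then show ?case
    proof cases
      case (conj a b c)
      then have abc: "a \<in> \<Gamma>" "b \<in> \<Gamma>" "c \<in> \<Gamma>" by simp_all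
      from conj(4) have uv: "u = [Gen_inv b, Gen a, Gen b]" "v = [Gen c]" by (simp_all add: conj_relation_def)
      have "pres_class \<Gamma> R u = pres_class \<Gamma> R v"
        using rel by (simp add: pres_class_eq_iff pres_cong.rel)
      then have "word_eval G g u = word_eval G g v" using eval_g rel by simp
      then have "g c = inv (g b) \<otimes> g a \<otimes> g b" using abc by (simp add: uv m_assoc)
      \<comment> \<open>The conjugation relation holds in \<open>G\<close>, so \<open>g c\<close> is
        exactly the index produced by the structure relation of \<open>g a\<close> and
        \<open>g b\<close>; no factor from \<open>N\<close> arises.\<close>
      then have "e a \<otimes>\<^bsub>?A\<^esub> e b = e b \<otimes>\<^bsub>?A\<^esub> e c"
        using abc structure_gen_comm[of "g a" "g b"] by (simp add: e_def)
      then have "E u = E v" using abc by (simp add: uv E_def) (simp flip: A.m_assoc)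
      then show ?thesis using rel subgroup.one_closed[OF N]
        by (intro bexI[of _ "\<one>\<^bsub>?A\<^esub>"]) simp_all
    next
      case ak: (power a k)
      let ?Q = "conj_class G (g a)"
      have Q: "?Q \<in> T" "q ?Q = e a [^]\<^bsub>?A\<^esub> k" using q_T[OF ak(1,2)] q_eq[OF ak(1,2)] ak rel by auto
      have uv: "u = replicate k (Gen a)" "v = []" using ak by (simp_all add: power_relation_def)
      have "E u = q ?Q \<otimes>\<^bsub>?A\<^esub> E v"
        \<comment> \<open>The word of a power relation evaluates to \<open>q ?Q\<close>, which is
          itself the required factor since \<open>E []\<close> is trivial.\<close>
        using ak Q by (simp add: uv E_def A.word_eval_replicate)
      moreover have "q ?Q \<in> N" using Q hq[OF Q(1)] unfolding N_def
        by (intro image_eqI[of _ _ "frag_of ?Q"]) simp_all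
      ultimately show ?thesis by blast
    qed
  qed

  let ?D = "E ` words \<Gamma>"
  have D: "subgroup ?D ?A"
  proof (rule A.subgroupI)
    show "?D \<subseteq> carrier ?A" by auto
    show "?D \<noteq> {}" using words_simps(1) by blast
    fix x assume "x \<in> ?D"
    then obtain u where u: "u \<in> words \<Gamma>" "x = E u" by blast
    show "inv\<^bsub>?A\<^esub> x \<in> ?D" using A.word_eval_inverse[OF e_Pi u(1)] u(2) unfolding E_def by (metis image_eqI)
    fix y assume "y \<in> ?D"
    then obtain v where v: "v \<in> words \<Gamma>" "y = E v" by blast
    show "x \<otimes>\<^bsub>?A\<^esub> y \<in> ?D" using u v E_append[OF u(1) v(1)] by (intro image_eqI[of _ _ "u @ v"]) simp_all
  qed
  have decomp: "\<exists>c\<in>K. \<exists>d\<in>?D. x = c \<otimes>\<^bsub>?A\<^esub> d" if x: "x \<in> carrier ?A" for x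
  proof -
    have "?p x \<in> \<phi> ` carrier (presented_group \<Gamma> R)" using \<phi> x by (simp add: Group.iso_iff)
    then obtain u where u: "u \<in> words \<Gamma>" "?p x = \<phi> (pres_class \<Gamma> R u)"
      by (auto elim: presented_groupE)
    \<comment> \<open>The word \<open>u\<close> and the element \<open>x\<close> have the same image
      in \<open>G\<close> because \<open>\<phi>\<close> is onto, so they differ by an element of the
      kernel.\<close>
    then have "x \<otimes>\<^bsub>?A\<^esub> inv\<^bsub>?A\<^esub> (E u) \<in> K" using x pi_E by (simp add: K_def kernel_def)
    moreover have "x = x \<otimes>\<^bsub>?A\<^esub> inv\<^bsub>?A\<^esub> (E u) \<otimes>\<^bsub>?A\<^esub> E u" using x u by (simp add: A.m_assoc)
    ultimately show ?thesis using u by blast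
  qed
  have "derived ?A (carrier ?A) \<subseteq> ?D"
    using D K_central KA decomp by (rule A.derived_subset_if_central_times_subgroup)
  then obtain u where u: "u \<in> words \<Gamma>" "z = E u" using structure_Ab_kernel[OF z Ab_z] by blast
  \<comment> \<open>Injectivity of \<open>\<phi>\<close> turns triviality of \<open>?p z\<close>
    into a congruence between \<open>u\<close> and the empty word, to which \<open>N_cong\<close>
    applies.\<close>
  have "\<phi> (pres_class \<Gamma> R u) = \<one>" using pi_E[OF u(1)] pi_z u(2) by simp
  then have "pres_class \<Gamma> R u = \<one>\<^bsub>presented_group \<Gamma> R\<^esub>"
    using \<phi> u(1) by (simp add: \<phi>.iso_iff)
  then have "pres_cong \<Gamma> R u []"
    using u(1) pres_class_eq_iff by (simp add: presented_group_def) blast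
  then obtain n where "n \<in> N" "E u = n \<otimes>\<^bsub>?A\<^esub> E []" using N_cong by blast
  then have "z \<in> N" using u(2) KA NK by (auto simp: E_def)
  then show ?thesis using N_Ab Ab_z by blast
qed

section \<open>The isomorphism with the fibre product\<close>

theorem theorem3p2:
  fixes G :: "('a, 'm) monoid_scheme"
  assumes "Cbar_group TYPE('g) G"
  shows "(\<lambda>z. (structure_pi G z, structure_Ab G z)) \<in> iso (structure_group G) (fibre_product G)"
proof -
  interpret group G using assms by (simp add: Cbar_group_def)
  let ?A = "structure_group G" and ?F = "\<lambda>z. (structure_pi G z, structure_Ab G z)"
  interpret A: group ?A by (rule group_structure_group)
  interpret p: group_hom ?A G "structure_pi G" by (rule group_hom_structure_pi)
  interpret Ab: group_hom ?A "free_Abelian_group (conj_classes G)" "structure_Ab G"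
    by (rule group_hom_structure_Ab)
  have hom: "?F \<in> hom ?A (fibre_product G)"
    using pi_bar_structure_Ab Ab.hom_closed
    by (auto intro!: homI simp: fibre_product_def DirProd_def)
  have inj: "inj_on ?F (carrier ?A)"
  proof (rule inj_onI)
    fix x y assume x: "x \<in> carrier ?A" and y: "y \<in> carrier ?A" and eq: "?F x = ?F y"
    have "structure_Ab G y \<in> carrier (free_Abelian_group (conj_classes G))"
      by (rule Ab.hom_closed[OF y])
    \<comment> \<open>The quotient of two elements with equal images lies in both kernels.\<close>
    then have "x \<otimes>\<^bsub>?A\<^esub> inv\<^bsub>?A\<^esub> y = \<one>\<^bsub>?A\<^esub>"
      using x y eq by (intro Cbar_kernel_trivial[OF assms]) simp_all
    then show "x = y" using x y by (metis A.inv_equality A.inv_inv A.inv_closed)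
  qed
  have "?F ` carrier ?A = carrier (fibre_product G)"
  proof
    show "?F ` carrier ?A \<subseteq> carrier (fibre_product G)" using hom by (auto simp: hom_def)
    show "carrier (fibre_product G) \<subseteq> ?F ` carrier ?A"
    proof
      fix w assume "w \<in> carrier (fibre_product G)"
      then obtain a x where "w = (a, x)" "a \<in> carrier G"
        "x \<in> carrier (free_Abelian_group (conj_classes G))" "ab_map G a = pi_bar G x"
        by (auto simp: fibre_product_def)
      then show "w \<in> ?F ` carrier ?A" using fibre_product_surj[of a x] by force
    qed
  qed
  then show ?thesis using hom inj by (simp add: Group.iso_iff)
qed

end
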